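(* There is no planar $D(4)$ graph.
   Context: All graphs are finite, simple and connected. $\gamma(G)$ denotes the domination number and $\chi(G)$ the chromatic number of $G$. A (proper) coloring of $G$ with $k$ colors is a partition $C=(V_1,\dots,V_k)$ of $V(G)$ into nonempty independent sets, called color classes. A vertex $u$ dominates the color class $V_i$ if $u$ is adjacent to every vertex of $V_i$, or if $V_i=\{u\}$. A dominator coloring of $G$ is a coloring in which every vertex dominates at least one color class; the dominator chromatic number $\chi_d(G)$ is the minimum number of colors in a dominator coloring of $G$. A graph $G$ is called a $D(k)$ graph if $\gamma(G)=\chi(G)=\chi_d(G)=k$. *)

theory Defs
  imports "HOL-Analysis.Analysis" "HOL-Library.Disjoint_Sets" "Graph_Theory.Digraph_Component"
begin

text \<open>
  The locale \<open>graph\<close> models finite simple graphs as symmetric loop-free digraphs without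
  parallel arcs, so that \<open>u \<rightarrow>\<^bsub>G\<^esub> v\<close> is the adjacency relation.
\<close>

definition dominating_set :: "('a, 'b) pre_digraph \<Rightarrow> 'a set \<Rightarrow> bool" where
  "dominating_set G D \<longleftrightarrow>
     D \<subseteq> verts G \<and> (\<forall>v \<in> verts G - D. \<exists>u \<in> D. u \<rightarrow>\<^bsub>G\<^esub> v)"

definition domination_number :: "('a, 'b) pre_digraph \<Rightarrow> nat" where
  "domination_number G = (LEAST k. \<exists>D. dominating_set G D \<and> card D = k)"

definition independent_set :: "('a, 'b) pre_digraph \<Rightarrow> 'a set \<Rightarrow> bool" where
  "independent_set G S \<longleftrightarrow> S \<subseteq> verts G \<and> (\<forall>u \<in> S. \<forall>v \<in> S. \<not> u \<rightarrow>\<^bsub>G\<^esub> v)"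

definition proper_coloring :: "('a, 'b) pre_digraph \<Rightarrow> 'a set set \<Rightarrow> bool" where
  "proper_coloring G C \<longleftrightarrow> partition_on (verts G) C \<and> (\<forall>S \<in> C. independent_set G S)"

definition chromatic_number :: "('a, 'b) pre_digraph \<Rightarrow> nat" where
  "chromatic_number G = (LEAST k. \<exists>C. proper_coloring G C \<and> card C = k)"

definition dominates_class :: "('a, 'b) pre_digraph \<Rightarrow> 'a \<Rightarrow> 'a set \<Rightarrow> bool" where
  "dominates_class G u S \<longleftrightarrow> (\<forall>v \<in> S. u \<rightarrow>\<^bsub>G\<^esub> v) \<or> S = {u}"

definition dominator_coloring :: "('a, 'b) pre_digraph \<Rightarrow> 'a set set \<Rightarrow> bool" where
  "dominator_coloring G C \<longleftrightarrow>
     proper_coloring G C \<and> (\<forall>u \<in> verts G. \<exists>S \<in> C. dominates_class G u S)"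

definition dominator_chromatic_number :: "('a, 'b) pre_digraph \<Rightarrow> nat" where
  "dominator_chromatic_number G = (LEAST k. \<exists>C. dominator_coloring G C \<and> card C = k)"

definition D_graph :: "nat \<Rightarrow> ('a, 'b) pre_digraph \<Rightarrow> bool" where
  "D_graph k G \<longleftrightarrow>
     domination_number G = k \<and> chromatic_number G = k \<and> dominator_chromatic_number G = k"

text \<open>
  A symmetric pair of opposite arcs is a single undirected edge and receives a single curve
  in a drawing, hence edges are represented by their two-element sets of ends.
\<close>

definition edge_sets :: "('a, 'b) pre_digraph \<Rightarrow> 'a set set" where
  "edge_sets G = {{u, v} | u v. u \<rightarrow>\<^bsub>G\<^esub> v}"

text \<open>
  Drawings in the plane (identified with \<open>complex\<close>) without crossings: \<open>p\<close> places the vertices,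
  and \<open>g e\<close> is a Jordan arc joining the two ends of the edge \<open>e\<close>, passing through no further
  vertex and meeting other edges at common ends only.
\<close>

definition plane_drawing ::
    "('a, 'b) pre_digraph \<Rightarrow> ('a \<Rightarrow> complex) \<Rightarrow> ('a set \<Rightarrow> real \<Rightarrow> complex) \<Rightarrow> bool" where
  "plane_drawing G p g \<longleftrightarrow>
     inj_on p (verts G) \<and>
     (\<forall>e \<in> edge_sets G.
        arc (g e) \<and> {pathstart (g e), pathfinish (g e)} = p ` e \<and>
        path_image (g e) \<inter> p ` verts G = p ` e) \<and>
     (\<forall>e \<in> edge_sets G. \<forall>f \<in> edge_sets G. e \<noteq> f \<longrightarrow>
        path_image (g e) \<inter> path_image (g f) \<subseteq> p ` (e \<inter> f))"

definition planar :: "('a, 'b) pre_digraph \<Rightarrow> bool" where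
  "planar G \<longleftrightarrow> (\<exists>p g. plane_drawing G p g)"

end

theory Submission
  imports Defs
begin

text \<open>
  In a dominator coloring with four classes, one vertex from each class always gives a
  dominating set, and choosing the representatives of three classes well leaves very little
  room for a vertex they do not dominate. If some class is a singleton, this already contradicts
  the domination number or yields a 3-coloring. Otherwise draw an arrow from a class to another
  one if some vertex of the first is adjacent to the whole second class. There is no directed
  3-cycle, so there is a 2-cycle, and then the other two classes form a 2-cycle as well. Now
  either the graph contains a subdivision of the complete bipartite graph on three and three
  vertices, or it consists of two complete bipartite graphs, each with a part of size two, and
  is bipartite. The subdivision is excluded by the theta curve theorem: of three arcs with common
  ends, one lies inside the Jordan curve formed by the other two and separates it.
\<close>

section \<open>Theta curves in the plane\<close>

text \<open>Running along \<open>c\<close> and back along \<open>d\<close> is a simple closed curve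
  with image \<open>J\<close>, so the Jordan curve theorem applies.\<close>

lemma Jordan_two_arcs:
  fixes c d :: "real \<Rightarrow> complex"
  assumes "arc c" "arc d" "pathstart c = a" "pathfinish c = b" "pathstart d = a" "pathfinish d = b"
    and int: "path_image c \<inter> path_image d = {a, b}"
  defines "J \<equiv> path_image c \<union> path_image d"
  shows "inside J \<noteq> {}" "topological_space_class.connected (inside J)"
    "topological_space_class.connected (outside J)" "frontier (inside J) = J"
    and "closed J"
proof -
  have s: "simple_path (c +++ reversepath d)"
    using assms by (intro simple_path_join_loop) (auto simp: arc_reversepath)
  have J: "path_image (c +++ reversepath d) = J"
    using assms by (simp add: path_image_join)
  have "pathfinish (c +++ reversepath d) = pathstart (c +++ reversepath d)"
    using assms by simp
  note * = Jordan_inside_outside [OF s this, unfolded J]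
  show "inside J \<noteq> {}" "topological_space_class.connected (inside J)"
    "topological_space_class.connected (outside J)" "frontier (inside J) = J"
    using * by auto
  show "closed J"
    using assms unfolding J_def by (simp add: closed_arc_image closed_Un)
qed

lemma connected_subset_inside:
  assumes "topological_space_class.connected T" "T \<inter> S = {}" "x \<in> T" "x \<in> inside S"
  shows "T \<subseteq> inside S"
proof
  fix y
  assume "y \<in> T"
  then have "connected_component (- S) x y"
    unfolding connected_component_def using assms by blast
  then show "y \<in> inside S"
    using assms(4) inside_same_component by blast
qed

text \<open>Indexing the arcs by the numbers below 3 lets one argument serve for every order of the
  three arcs.\<close>

locale theta_curve =
  fixes c :: "nat \<Rightarrow> real \<Rightarrow> complex" and a b :: complex
  assumes arcs: "i < 3 \<Longrightarrow> arc (c i)"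
    and ends: "i < 3 \<Longrightarrow> pathstart (c i) = a" "i < 3 \<Longrightarrow> pathfinish (c i) = b"
    and meet: "i < 3 \<Longrightarrow> j < 3 \<Longrightarrow> i \<noteq> j \<Longrightarrow> path_image (c i) \<inter> path_image (c j) = {a, b}"
begin

abbreviation P :: "nat \<Rightarrow> complex set" where "P i \<equiv> path_image (c i)"

lemma ends_distinct: "a \<noteq> b"
  using arc_distinct_ends [OF arcs [of 0]] ends [of 0] by simp

lemma interior_point: "i < 3 \<Longrightarrow> \<exists>x \<in> P i. x \<noteq> a \<and> x \<noteq> b"
  using nonempty_simple_path_endless [OF arc_imp_simple_path [OF arcs]] ends by fastforce

lemma Jordan:
  assumes "i < 3" "j < 3" "i \<noteq> j"
  shows "inside (P i \<union> P j) \<noteq> {}" "topological_space_class.connected (inside (P i \<union> P j))"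
    "topological_space_class.connected (outside (P i \<union> P j))" "frontier (inside (P i \<union> P j)) = P i \<union> P j"
    "closed (P i \<union> P j)"
  using Jordan_two_arcs [of "c i" "c j" a b] assms arcs ends meet by auto

text \<open>The region inside \<open>P i \<union> P k\<close> is connected and misses
  \<open>P i \<union> P j\<close>, so the common point \<open>x\<close> puts it inside
  \<open>P i \<union> P j\<close>. Its frontier contains \<open>P k\<close>, and an interior point
  of \<open>P k\<close> lies on neither \<open>P i\<close> nor \<open>P j\<close>.\<close>

lemma inside_subset_imp_arc_inside:
  assumes ijk: "i < 3" "j < 3" "k < 3" "i \<noteq> j" "j \<noteq> k" "i \<noteq> k"
    and x: "x \<in> inside (P i \<union> P k)" "x \<in> inside (P i \<union> P j)"
    and disj: "P j \<inter> inside (P i \<union> P k) = {}"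
  shows "P k \<inter> inside (P i \<union> P j) \<noteq> {}"
proof -
  have "inside (P i \<union> P k) \<inter> (P i \<union> P j) = {}"
    using disj inside_no_overlap [of "P i \<union> P k"] by blast
  then have "inside (P i \<union> P k) \<subseteq> inside (P i \<union> P j)"
    using x Jordan(2) [of i k] ijk by (intro connected_subset_inside) auto
  then have "P k \<subseteq> closure (inside (P i \<union> P j))"
    using Jordan(4) [of i k] ijk by (metis closure_Un_frontier closure_mono le_sup_iff)
  then have "P k \<subseteq> P i \<union> P j \<union> inside (P i \<union> P j)"
    using closure_inside_subset [OF Jordan(5) [of i j]] ijk by auto
  then show ?thesis
    using interior_point [of k] meet [of k i] meet [of k j] ijk by blast
qed

text \<open>Otherwise a point \<open>x\<close> inside \<open>P 0 \<union> P 2\<close> is inside one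
  of the other two closed curves as well, for it cannot be outside both of them. The overlap of
  insides forces an arc into an inside by the previous lemma.\<close>

lemma some_arc_inside:
  "P 0 \<inter> inside (P 1 \<union> P 2) \<noteq> {} \<or> P 1 \<inter> inside (P 0 \<union> P 2) \<noteq> {} \<or> P 2 \<inter> inside (P 0 \<union> P 1) \<noteq> {}"
proof (rule ccontr)
  assume "\<not> ?thesis"
  then have no: "P 0 \<inter> inside (P 1 \<union> P 2) = {}" "P 1 \<inter> inside (P 0 \<union> P 2) = {}"
    "P 2 \<inter> inside (P 0 \<union> P 1) = {}" by auto
  obtain x where x: "x \<in> inside (P 0 \<union> P 2)"
    using Jordan(1) [of 0 2] by auto
  have bnd: "compact (P i)" if "i < 3" for i
    using arcs that by (simp add: arc_imp_path compact_path_image)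
  obtain y where y: "y \<in> outside (P 0 \<union> P 1 \<union> P 2)"
    using outside_bounded_nonempty [of "P 0 \<union> P 1 \<union> P 2"] bnd by (auto simp: compact_imp_bounded)
  have y01: "y \<in> outside (P 0 \<union> P 1)" and y12: "y \<in> outside (P 1 \<union> P 2)"
    using y outside_mono [of _ "P 0 \<union> P 1 \<union> P 2"] by (meson le_sup_iff subsetD sup_ge1 sup_ge2 order_trans)+
  have cc: "connected_component (- (P i \<union> P j)) x y"
    if "i < 3" "j < 3" "i \<noteq> j" "x \<in> outside (P i \<union> P j)" "y \<in> outside (P i \<union> P j)" for i j
    unfolding connected_component_def
    using that Jordan(3) [of i j] by (intro exI [of _ "outside (P i \<union> P j)"]) (auto simp: outside_def)
  have "x \<notin> outside (P 0 \<union> P 1) \<or> x \<notin> outside (P 1 \<union> P 2)"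
  proof (rule ccontr)
    assume far: "\<not> ?thesis"
    \<comment> \<open>Janiszewski's theorem: neither of two compact sets separates \<open>x\<close>
      from \<open>y\<close>, and their intersection is the connected set \<open>P 1\<close>; hence
      their union does not separate the points either.\<close>
    have *: "(P 0 \<union> P 1) \<inter> (P 1 \<union> P 2) = P 1"
      using meet [of 0 2] meet [of 0 1] by auto
    have "topological_space_class.connected ((P 0 \<union> P 1) \<inter> (P 1 \<union> P 2))"
      unfolding * using arcs [of 1] by (simp add: connected_arc_image)
    then have "connected_component (- ((P 0 \<union> P 1) \<union> (P 1 \<union> P 2))) x y"
      by (rule Janiszewski_weak [rotated 2])
        (use far y01 y12 cc [of 0 1] cc [of 1 2] in \<open>auto simp: bnd compact_Un\<close>)
    moreover have "(P 0 \<union> P 1) \<union> (P 1 \<union> P 2) = P 0 \<union> P 1 \<union> P 2"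
      by auto
    ultimately have "connected_component (- (P 0 \<union> P 1 \<union> P 2)) x y"
      by (simp only:)
    then have "x \<in> outside (P 0 \<union> P 1 \<union> P 2)"
      using y outside_same_component connected_component_sym by blast
    then have "x \<in> outside (P 0 \<union> P 2)"
      using outside_mono [of "P 0 \<union> P 2" "P 0 \<union> P 1 \<union> P 2"] by auto
    with x show False
      using inside_Int_outside by fastforce
  qed
  moreover have "x \<notin> P 0 \<union> P 1 \<union> P 2"
    using x no inside_no_overlap [of "P 0 \<union> P 2"] by blast
  ultimately have "x \<in> inside (P 0 \<union> P 1) \<or> x \<in> inside (P 1 \<union> P 2)"
    by (auto simp: outside_inside)
  then show False
    using inside_subset_imp_arc_inside [of 0 1 2 x] inside_subset_imp_arc_inside [of 2 1 0 x] x no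
    by (auto simp: Un_commute)
qed

text \<open>The arc \<open>P i\<close> cuts the inside of \<open>P j \<union> P k\<close> into two
  regions. Since \<open>p i\<close> is inside, so is \<open>x\<close>, which then lies in one of the
  regions, say the one bounded by \<open>P i\<close> and \<open>P j\<close>. This region also
  contains \<open>p k\<close>, although \<open>p k\<close> is on the curve
  \<open>P j \<union> P k\<close>.\<close>

lemma no_point_near_all_arcs_if_inside:
  assumes ijk: "i < 3" "j < 3" "k < 3" "i \<noteq> j" "j \<noteq> k" "i \<noteq> k"
    and inside: "P i \<inter> inside (P j \<union> P k) \<noteq> {}"
    and x: "x \<notin> P i"
    and p: "p i \<in> P i" "p j \<in> P j" "p k \<in> P k" "p i \<notin> {a, b}" "p j \<notin> {a, b}" "p k \<notin> {a, b}"
    and cc: "connected_component (- (P j \<union> P k)) x (p i)" "connected_component (- (P i \<union> P k)) x (p j)"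
      "connected_component (- (P i \<union> P j)) x (p k)"
  shows False
proof -
  obtain "inside (P j \<union> P i) \<inter> inside (P k \<union> P i) = {}"
    and split: "inside (P j \<union> P i) \<union> inside (P k \<union> P i) \<union> (P i - {a, b}) = inside (P j \<union> P k)"
    using split_inside_simple_closed_curve [of "c j" a b "c k" "c i"] ijk arcs ends meet inside
      ends_distinct by (metis arc_imp_simple_path)
  have "p i \<in> inside (P j \<union> P k)"
    using split p by auto
  then have "x \<in> inside (P j \<union> P k)"
    using cc(1) by (meson connected_component_sym inside_same_component)
  then have "x \<in> inside (P j \<union> P i) \<or> x \<in> inside (P k \<union> P i)"
    using split x by auto
  then have "p k \<in> inside (P j \<union> P i) \<or> p j \<in> inside (P k \<union> P i)"
    using cc by (metis Un_commute inside_same_component)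
  then have "p k \<in> inside (P j \<union> P k) \<or> p j \<in> inside (P j \<union> P k)"
    using split by auto
  then show False
    using p inside_no_overlap by fastforce
qed

text \<open>In the application \<open>x\<close> is a sixth branch vertex, and \<open>p 0\<close>,
  \<open>p 1\<close>, \<open>p 2\<close> are its three neighbours or the end of a walk from it.
  Components are used instead of arcs, so that any connected set avoiding the two other arcs will
  do.\<close>

lemma no_point_near_all_arcs:
  fixes p :: "nat \<Rightarrow> complex"
  assumes "x \<notin> P 0 \<union> P 1 \<union> P 2"
    and "p 0 \<in> P 0" "p 1 \<in> P 1" "p 2 \<in> P 2" "p 0 \<notin> {a, b}" "p 1 \<notin> {a, b}" "p 2 \<notin> {a, b}"
    and "connected_component (- (P 1 \<union> P 2)) x (p 0)" "connected_component (- (P 0 \<union> P 2)) x (p 1)"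
      "connected_component (- (P 0 \<union> P 1)) x (p 2)"
  shows False
  using some_arc_inside
proof (elim disjE)
  assume "P 0 \<inter> inside (P 1 \<union> P 2) \<noteq> {}"
  then show False
    using no_point_near_all_arcs_if_inside [of 0 1 2 x p] assms by simp
next
  assume "P 1 \<inter> inside (P 0 \<union> P 2) \<noteq> {}"
  then show False
    using no_point_near_all_arcs_if_inside [of 1 0 2 x p] assms by (simp add: Un_commute)
next
  assume "P 2 \<inter> inside (P 0 \<union> P 1) \<noteq> {}"
  then show False
    using no_point_near_all_arcs_if_inside [of 2 0 1 x p] assms by (simp add: Un_commute)
qed

end

section \<open>Subdivisions of the complete bipartite graph on three and three vertices\<close>

text \<open>A drawing assigns a curve to an unordered pair, so its direction is unknown and it may
  have to be reversed.\<close>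

lemma drawn_edge_arc:
  assumes "plane_drawing G p g" "u \<rightarrow>\<^bsub>G\<^esub> v"
  obtains h where "arc h" "pathstart h = p u" "pathfinish h = p v" "path_image h = path_image (g {u, v})"
proof -
  have e: "{u, v} \<in> edge_sets G"
    using assms(2) by (auto simp: edge_sets_def)
  then have g: "arc (g {u, v})" "{pathstart (g {u, v}), pathfinish (g {u, v})} = {p u, p v}"
    using assms(1) by (simp_all add: plane_drawing_def)
  then consider "pathstart (g {u, v}) = p u" "pathfinish (g {u, v}) = p v"
    | "pathstart (g {u, v}) = p v" "pathfinish (g {u, v}) = p u"
    by (auto simp: doubleton_eq_iff)
  then show thesis
    using g(1) that [of "g {u, v}"] that [of "reversepath (g {u, v})"]
    by cases (auto simp: arc_reversepath)
qed

text \<open>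
  The edge from \<open>b2\<close> to \<open>a2\<close> is replaced by a walk of length three. A direct edge is
  covered by \<open>w = a2\<close> and \<open>z = b2\<close>.
\<close>

lemma planar_no_K33:
  fixes G :: "('a, 'b) pre_digraph"
  assumes "planar G" "wf_digraph G" and sym: "\<And>u v. u \<rightarrow>\<^bsub>G\<^esub> v \<Longrightarrow> v \<rightarrow>\<^bsub>G\<^esub> u"
    and dist: "distinct [a0, a1, a2, b0, b1, b2 :: 'a]"
    and adj: "a0 \<rightarrow>\<^bsub>G\<^esub> b0" "a0 \<rightarrow>\<^bsub>G\<^esub> b1" "a0 \<rightarrow>\<^bsub>G\<^esub> b2" "a1 \<rightarrow>\<^bsub>G\<^esub> b0" "a1 \<rightarrow>\<^bsub>G\<^esub> b1" "a1 \<rightarrow>\<^bsub>G\<^esub> b2"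
      "a2 \<rightarrow>\<^bsub>G\<^esub> b0" "a2 \<rightarrow>\<^bsub>G\<^esub> b1"
    and walk: "b2 \<rightarrow>\<^bsub>G\<^esub> w" "w \<rightarrow>\<^bsub>G\<^esub> z" "z \<rightarrow>\<^bsub>G\<^esub> a2"
    and avoid: "w \<notin> {a0, a1, b0, b1}" "z \<notin> {a0, a1, b0, b1}"
  shows False
proof -
  note adj_in_verts = wf_digraph.adj_in_verts [OF \<open>wf_digraph G\<close>]
  obtain p g where pd: "plane_drawing G p g"
    using assms(1) by (auto simp: planar_def)
  have "inj_on p (verts G)"
    using pd by (simp add: plane_drawing_def)
  then have inj: "p u = p v \<longleftrightarrow> u = v" if "u \<in> verts G" "v \<in> verts G" for u v
    using that by (simp add: inj_on_eq_iff)
  have V: "{a0, a1, a2, b0, b1, b2, w, z} \<subseteq> verts G"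
    using adj walk adj_in_verts by blast
  define I where "I u v = path_image (g {u, v})" for u v
  have I_commute: "I u v = I v u" for u v
    by (simp add: I_def insert_commute)
  have edges_meet: "I u v \<inter> I u' v' \<subseteq> p ` ({u, v} \<inter> {u', v'})"
    if "u \<rightarrow>\<^bsub>G\<^esub> v" "u' \<rightarrow>\<^bsub>G\<^esub> v'" "{u, v} \<noteq> {u', v'}" for u v u' v'
  proof -
    have "{u, v} \<in> edge_sets G" "{u', v'} \<in> edge_sets G"
      using that unfolding edge_sets_def by blast+
    then show ?thesis
      using pd that(3) unfolding plane_drawing_def I_def by metis
  qed
  have vert: "p x \<in> I u v \<longleftrightarrow> x \<in> {u, v}" if "u \<rightarrow>\<^bsub>G\<^esub> v" "x \<in> verts G" for u v x
  proof -
    have "{u, v} \<in> edge_sets G"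
      using that unfolding edge_sets_def by blast
    then have "I u v \<inter> p ` verts G = p ` {u, v}"
      using pd unfolding plane_drawing_def I_def by metis
    then show ?thesis
      using inj that adj_in_verts by blast
  qed
  have conn: "topological_space_class.connected (I u v)" if "u \<rightarrow>\<^bsub>G\<^esub> v" for u v
    using drawn_edge_arc [OF pd that] unfolding I_def by (metis connected_arc_image)
  \<comment> \<open>The theta curve has the ends \<open>b0\<close> and \<open>b1\<close>; each of
    its arcs runs through one of \<open>a0\<close>, \<open>a1\<close>, \<open>a2\<close>.\<close>
  have route: "\<exists>h. arc h \<and> pathstart h = p b0 \<and> pathfinish h = p b1 \<and> path_image h = I x b0 \<union> I x b1"
    if x: "x \<in> {a0, a1, a2}" for x
  proof -
    have x0: "b0 \<rightarrow>\<^bsub>G\<^esub> x" and x1: "x \<rightarrow>\<^bsub>G\<^esub> b1"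
      using x adj sym by auto
    obtain h1 where h1: "arc h1" "pathstart h1 = p b0" "pathfinish h1 = p x" "path_image h1 = I x b0"
      using drawn_edge_arc [OF pd x0] unfolding I_def by (metis insert_commute)
    obtain h2 where h2: "arc h2" "pathstart h2 = p x" "pathfinish h2 = p b1" "path_image h2 = I x b1"
      using drawn_edge_arc [OF pd x1] unfolding I_def by metis
    have "I b0 x \<inter> I x b1 \<subseteq> {p x}"
      using edges_meet [OF x0 x1] x dist by (auto simp: doubleton_eq_iff)
    then show ?thesis
      using h1 h2 by (intro exI [of _ "h1 +++ h2"]) (auto simp: arc_join path_image_join I_commute)
  qed
  \<comment> \<open>The default \<open>a2\<close> for all larger indices makes the facts on
    \<open>A\<close> and \<open>c\<close> hold without a bound on the index.\<close>
  define A where "A i = (if i = 0 then a0 else if i = 1 then a1 else a2)" for i :: nat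
  have A_in: "A i \<in> {a0, a1, a2}" for i
    by (simp add: A_def)
  then have "\<forall>i. \<exists>h. arc h \<and> pathstart h = p b0 \<and> pathfinish h = p b1 \<and>
      path_image h = I (A i) b0 \<union> I (A i) b1"
    using route by blast
  then obtain c where "\<forall>i. arc (c i) \<and> pathstart (c i) = p b0 \<and> pathfinish (c i) = p b1 \<and>
      path_image (c i) = I (A i) b0 \<union> I (A i) b1"
    unfolding choice_iff by blast
  then have c: "arc (c i)" "pathstart (c i) = p b0" "pathfinish (c i) = p b1"
    "path_image (c i) = I (A i) b0 \<union> I (A i) b1" for i
    by blast+
  have A_adj: "A i \<rightarrow>\<^bsub>G\<^esub> b0" "A i \<rightarrow>\<^bsub>G\<^esub> b1" for i
    using adj by (auto simp: A_def)
  have A_ne: "A i \<notin> {b0, b1, b2}" for i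
    using dist by (auto simp: A_def)
  interpret theta_curve c "p b0" "p b1"
  proof
    fix i j :: nat
    assume ij: "i < 3" "j < 3" "i \<noteq> j"
    then have ne: "A i \<noteq> A j"
      using dist by (auto simp: A_def)
    have "path_image (c i) \<inter> path_image (c j) \<subseteq> {p b0, p b1}"
      unfolding c using ne A_ne [of i] A_ne [of j] dist
        edges_meet [OF A_adj(1) [of i] A_adj(1) [of j]] edges_meet [OF A_adj(1) [of i] A_adj(2) [of j]]
        edges_meet [OF A_adj(2) [of i] A_adj(1) [of j]] edges_meet [OF A_adj(2) [of i] A_adj(2) [of j]]
      by (auto simp: doubleton_eq_iff)
    moreover have "{p b0, p b1} \<subseteq> path_image (c i) \<inter> path_image (c j)"
      using c pathstart_in_path_image pathfinish_in_path_image by (metis Int_iff empty_subsetI insert_subset)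
    ultimately show "path_image (c i) \<inter> path_image (c j) = {p b0, p b1}" by auto
  qed (use c in auto)
  define q where "q i = p (A i)" for i
  have q: "q i \<in> P i \<and> q i \<notin> {p b0, p b1}" for i
  proof -
    have "A i \<in> verts G" "b0 \<in> verts G" "b1 \<in> verts G"
      using A_in [of i] V by auto
    then show ?thesis
      using vert [OF A_adj(1) [of i], of "A i"] A_ne [of i] unfolding c q_def by (simp add: inj)
  qed
  have disj: "I u v \<inter> path_image (c i) = {}"
    if "u \<rightarrow>\<^bsub>G\<^esub> v" "{u, v} \<inter> {A i, b0, b1} = {}" for u v i
    unfolding c using that edges_meet [OF that(1) A_adj(1) [of i]] edges_meet [OF that(1) A_adj(2) [of i]] by auto
  have cc: "connected_component (- (P i \<union> P j)) x y"
    if "topological_space_class.connected S" "x \<in> S" "y \<in> S" "S \<inter> P i = {}" "S \<inter> P j = {}" for S i j x y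
    unfolding connected_component_def using that by (intro exI [of _ S]) auto
  have b2_adj: "b2 \<rightarrow>\<^bsub>G\<^esub> a0" "b2 \<rightarrow>\<^bsub>G\<^esub> a1"
    using adj sym by auto
  have A012: "A 0 = a0" "A (Suc 0) = a1" "A 2 = a2"
    by (auto simp: A_def)
  \<comment> \<open>The walk may repeat vertices or edges, so its drawing need not be an arc;
    connectedness is what survives.\<close>
  have W: "topological_space_class.connected (I b2 w \<union> I w z \<union> I z a2)"
    using conn walk vert [OF walk(1), of w] vert [OF walk(2), of w] vert [OF walk(2), of z]
      vert [OF walk(3), of z] V by (intro connected_Un) auto
  show False
  proof (rule no_point_near_all_arcs [of "p b2" q])
    show "p b2 \<notin> P 0 \<union> P 1 \<union> P 2"
      unfolding c using vert [OF A_adj(1), of b2] vert [OF A_adj(2), of b2] V A_ne dist by auto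
    show "q 0 \<in> P 0" "q 1 \<in> P 1" "q 2 \<in> P 2" "q 0 \<notin> {p b0, p b1}" "q 1 \<notin> {p b0, p b1}"
      "q 2 \<notin> {p b0, p b1}"
      using q by blast+
    show "connected_component (- (P 1 \<union> P 2)) (p b2) (q 0)"
      using b2_adj(1) dist V
      by (intro cc [of "I b2 a0"] conn disj) (auto simp: A012 q_def vert)
    show "connected_component (- (P 0 \<union> P 2)) (p b2) (q 1)"
      using b2_adj(2) dist V
      by (intro cc [of "I b2 a1"] conn disj) (auto simp: A012 q_def vert)
    show "connected_component (- (P 0 \<union> P 1)) (p b2) (q 2)"
    proof (rule cc [OF W])
      \<comment> \<open>By \<open>avoid\<close>, the walk stays off the arcs through
        \<open>a0\<close> and \<open>a1\<close>.\<close>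
      have "(I b2 w \<union> I w z \<union> I z a2) \<inter> P i = {}" if "i < 2" for i
      proof -
        have "A i \<in> {a0, a1}"
          using that by (auto simp: A_def)
        then have "{b2, w} \<inter> {A i, b0, b1} = {}" "{w, z} \<inter> {A i, b0, b1} = {}"
          "{z, a2} \<inter> {A i, b0, b1} = {}"
          using avoid dist by auto
        then have "I b2 w \<inter> P i = {}" "I w z \<inter> P i = {}" "I z a2 \<inter> P i = {}"
          using disj [OF walk(1), of i] disj [OF walk(2), of i] disj [OF walk(3), of i] by simp_all
        then show ?thesis
          by (simp add: Int_Un_distrib2)
      qed
      then show "(I b2 w \<union> I w z \<union> I z a2) \<inter> P 0 = {}" "(I b2 w \<union> I w z \<union> I z a2) \<inter> P 1 = {}"
        by simp_all
    qed (use V walk in \<open>auto simp: vert q_def A012\<close>)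
  qed
qed

section \<open>Dominator colorings with four classes\<close>

text \<open>The last two assumptions express that the domination and chromatic numbers exceed 3. The
  three vertices may coincide, and the three independent sets may be empty.\<close>

locale dominator_4_coloring =
  fixes G :: "('a, 'b) pre_digraph" and C :: "'a set set"
  assumes graph: "graph G"
    and coloring: "dominator_coloring G C"
    and three_vertices: "\<lbrakk>x \<in> verts G; y \<in> verts G; z \<in> verts G\<rbrakk> \<Longrightarrow>
      \<exists>v \<in> verts G. v \<notin> {x, y, z} \<and> \<not> v \<rightarrow>\<^bsub>G\<^esub> x \<and> \<not> v \<rightarrow>\<^bsub>G\<^esub> y \<and> \<not> v \<rightarrow>\<^bsub>G\<^esub> z"
    and not_3_colorable: "\<lbrakk>independent_set G S; independent_set G T; independent_set G U;
      S \<inter> T = {}; S \<inter> U = {}; T \<inter> U = {}; S \<union> T \<union> U = verts G\<rbrakk> \<Longrightarrow> False"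
begin

abbreviation adj (infix "\<sim>" 50) where "u \<sim> v \<equiv> u \<rightarrow>\<^bsub>G\<^esub> v"

abbreviation nontrivial :: "'a set \<Rightarrow> bool" where "nontrivial S \<equiv> \<nexists>v. S = {v}"

abbreviation dominates :: "'a \<Rightarrow> 'a set \<Rightarrow> bool" where "dominates \<equiv> dominates_class G"

text \<open>This is domination of a class without the alternative \<open>S = {u}\<close>; the two
  notions agree on nontrivial classes.\<close>

definition complete_to :: "'a \<Rightarrow> 'a set \<Rightarrow> bool" where
  "complete_to u S \<longleftrightarrow> (\<forall>v \<in> S. u \<sim> v)"

definition arrow :: "'a set \<Rightarrow> 'a set \<Rightarrow> bool" (infix "\<leadsto>" 50) where
  "X \<leadsto> Y \<longleftrightarrow> (\<exists>x \<in> X. complete_to x Y)"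

definition classes :: "'a set \<Rightarrow> 'a set \<Rightarrow> 'a set \<Rightarrow> 'a set \<Rightarrow> bool" where
  "classes X Y Z W \<longleftrightarrow> distinct [X, Y, Z, W] \<and> C = {X, Y, Z, W}"

text \<open>Adjacent transpositions generate all orders of the four classes, which is how arguments
  by symmetry are carried out.\<close>

lemma classes_swap:
  assumes "classes X Y Z W"
  shows "classes Y X Z W" "classes X Z Y W" "classes X Y W Z"
  using assms unfolding classes_def by (simp_all add: insert_commute) metis+

lemma adj_sym:
  assumes "u \<sim> v"
  shows "v \<sim> u"
proof -
  have "sym_digraph G"
    using graph by (simp add: graph_def pseudo_graph_def)
  then show ?thesis
    using assms by (rule sym_digraph.graph_symmetric)
qed

lemma adj_irrefl: "\<not> u \<sim> u"
proof
  assume "u \<sim> u"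
  moreover have "loopfree_digraph G"
    using graph by (simp add: graph_def digraph_def)
  ultimately show False
    by (metis loopfree_digraph.adj_not_same)
qed

lemma classes_cover: "classes X Y Z W \<Longrightarrow> verts G = X \<union> Y \<union> Z \<union> W"
  using coloring
  by (auto simp: dominator_coloring_def proper_coloring_def partition_on_def classes_def)

lemma classes_disjoint:
  "classes X Y Z W \<Longrightarrow> X \<inter> Y = {} \<and> X \<inter> Z = {} \<and> X \<inter> W = {} \<and> Y \<inter> Z = {} \<and> Y \<inter> W = {} \<and> Z \<inter> W = {}"
  using coloring
  by (simp add: dominator_coloring_def proper_coloring_def partition_on_def classes_def disjoint_def)

lemma classes_nonempty: "classes X Y Z W \<Longrightarrow> X \<noteq> {} \<and> Y \<noteq> {} \<and> Z \<noteq> {} \<and> W \<noteq> {}"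
  using coloring
  by (auto simp: dominator_coloring_def proper_coloring_def partition_on_def classes_def)

lemma classes_independent: "classes X Y Z W \<Longrightarrow>
    independent_set G X \<and> independent_set G Y \<and> independent_set G Z \<and> independent_set G W"
  using coloring by (auto simp: dominator_coloring_def proper_coloring_def classes_def)

lemma classes_dominate:
  assumes "classes X Y Z W" "u \<in> verts G"
  shows "dominates u X \<or> dominates u Y \<or> dominates u Z \<or> dominates u W"
  using coloring assms by (simp add: dominator_coloring_def classes_def)

lemma complete_toD: "complete_to u S \<Longrightarrow> v \<in> S \<Longrightarrow> u \<sim> v"
  by (simp add: complete_to_def)

lemma dominates_own: "dominates u S \<Longrightarrow> u \<in> S \<Longrightarrow> S = {u}"
  using adj_irrefl by (auto simp: dominates_class_def)

lemma dominates_nontrivial: "dominates u S \<Longrightarrow> nontrivial S \<Longrightarrow> complete_to u S \<and> u \<notin> S"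
  using adj_irrefl by (auto simp: dominates_class_def complete_to_def)

text \<open>The vertex \<open>v\<close> is one that \<open>{x, y, z}\<close> fails to dominate. If
  \<open>x\<close>, \<open>y\<close>, \<open>z\<close> represent three classes, \<open>v\<close>
  must dominate the fourth class, and it lies in no class to which one of them is complete.\<close>

lemma avoiding_vertex:
  assumes "x \<in> verts G" "y \<in> verts G" "z \<in> verts G"
  obtains v where "v \<in> verts G" "v \<notin> {x, y, z}"
    "\<And>s. s \<in> {x, y, z} \<Longrightarrow> \<not> v \<sim> s \<and> \<not> s \<sim> v"
    "\<And>s S. s \<in> {x, y, z} \<Longrightarrow> s \<in> S \<Longrightarrow> \<not> dominates v S"
    "\<And>s S. s \<in> {x, y, z} \<Longrightarrow> complete_to s S \<Longrightarrow> v \<notin> S"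
proof -
  obtain v where v: "v \<in> verts G" "v \<notin> {x, y, z}" "\<not> v \<sim> x" "\<not> v \<sim> y" "\<not> v \<sim> z"
    using three_vertices [OF assms] by blast
  then have adj: "\<not> v \<sim> s \<and> \<not> s \<sim> v" if "s \<in> {x, y, z}" for s
    using that adj_sym by blast
  show thesis
  proof
    fix s S
    assume s: "s \<in> {x, y, z}"
    show "\<not> dominates v S" if "s \<in> S"
      using that adj [OF s] v(2) s unfolding dominates_class_def by blast
    show "v \<notin> S" if "complete_to s S"
      using that adj [OF s] complete_toD by blast
    show "\<not> v \<sim> s \<and> \<not> s \<sim> v"
      by (rule adj [OF s])
  qed (fact v)+
qed

section \<open>Colorings with a singleton class\<close>

lemma no_three_singletons: "\<not> classes {a} {b} {c} D"
proof
  assume q: "classes {a} {b} {c} D"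
  note cover = classes_cover [OF q] and disjoint = classes_disjoint [OF q]
  obtain v where v: "v \<in> verts G" "v \<notin> {a, b, c}"
    and adj: "\<And>s. s \<in> {a, b, c} \<Longrightarrow> \<not> v \<sim> s \<and> \<not> s \<sim> v"
    and "\<And>s S. s \<in> {a, b, c} \<Longrightarrow> s \<in> S \<Longrightarrow> \<not> dominates v S"
    by (rule avoiding_vertex [of a b c]) (use cover in auto)
  then have "dominates v D"
    using classes_dominate [OF q v(1)] by blast
  moreover have "v \<in> D"
    using v cover by auto
  ultimately have "D = {v}"
    by (rule dominates_own)
  \<comment> \<open>The graph has just the vertices \<open>a\<close>, \<open>b\<close>,
    \<open>c\<close>, \<open>v\<close>, and \<open>v\<close> can share the color of
    \<open>a\<close>.\<close>
  then show False
    using v adj cover disjoint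
    by (intro not_3_colorable [of "{a, v}" "{b}" "{c}"]) (auto simp: independent_set_def adj_irrefl)
qed

text \<open>Avoiding \<open>a\<close>, \<open>b\<close> and a vertex of \<open>X\<close> gives a
  vertex of \<open>X\<close> complete to \<open>Y\<close>, and vice versa. Avoiding \<open>a\<close>
  and these two vertices leaves only \<open>b\<close>, so \<open>a\<close> and \<open>b\<close> are
  not adjacent and can share a color.\<close>

lemma no_two_singletons: "\<not> classes {a} {b} X Y"
proof
  assume q: "classes {a} {b} X Y"
  note cover = classes_cover [OF q] and disjoint = classes_disjoint [OF q]
  have nt: "nontrivial X" "nontrivial Y"
    using q classes_swap(3) [OF q] no_three_singletons by blast+
  have exclusive: "\<exists>v \<in> X. complete_to v Y"
    if q: "classes {a} {b} X Y" and nt: "nontrivial Y" for X Y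
  proof -
    note cover = classes_cover [OF q]
    obtain x where x: "x \<in> X"
      using classes_nonempty [OF q] by auto
    obtain v where v: "v \<in> verts G" "v \<notin> {a, b, x}"
      and "\<And>s S. s \<in> {a, b, x} \<Longrightarrow> s \<in> S \<Longrightarrow> \<not> dominates v S"
      by (rule avoiding_vertex [of a b x]) (use cover x in auto)
    then have "dominates v Y"
      using classes_dominate [OF q v(1)] x by blast
    then have "complete_to v Y" "v \<notin> Y"
      using dominates_nontrivial [OF _ nt] by simp_all
    then show ?thesis
      using v cover by blast
  qed
  obtain x where x: "x \<in> X" "complete_to x Y"
    using exclusive [OF q] nt by auto
  obtain y where y: "y \<in> Y" "complete_to y X"
    using exclusive [OF classes_swap(3) [OF q]] nt by auto
  obtain v where v: "v \<in> verts G" "v \<notin> {a, x, y}"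
    and adj: "\<And>s. s \<in> {a, x, y} \<Longrightarrow> \<not> v \<sim> s \<and> \<not> s \<sim> v"
    and nc: "\<And>s S. s \<in> {a, x, y} \<Longrightarrow> complete_to s S \<Longrightarrow> v \<notin> S"
    by (rule avoiding_vertex [of a x y]) (use cover x y in auto)
  have "v \<notin> Y" "v \<notin> X"
    using nc [OF _ x(2)] nc [OF _ y(2)] by simp_all
  then have "v = b"
    using v cover by auto
  then have "\<not> a \<sim> b" "\<not> b \<sim> a"
    using adj [of a] by simp_all
  then have "independent_set G {a, b}"
    using cover by (auto simp: independent_set_def adj_irrefl)
  then show False
    using classes_independent [OF q] cover disjoint
    by (intro not_3_colorable [of "{a, b}" X Y]) auto
qed

text \<open>With \<open>a\<close> always among the avoided vertices, each of the three other classes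
  receives an arrow from another one of them. Such a digraph on three classes has a 2-cycle or a
  3-cycle, and both are excluded.\<close>

lemma one_singleton:
  assumes "classes {a} X Y Z"
  shows False
proof -
  have nt: "nontrivial X \<and> nontrivial Y \<and> nontrivial Z" if "classes {a} X Y Z" for X Y Z
    using that no_two_singletons classes_swap by metis
  have avoid: "\<exists>v. v \<in> X \<union> Y \<union> Z \<and> complete_to v Z \<and> v \<notin> Z \<and>
      (\<forall>S. complete_to x S \<or> complete_to y S \<longrightarrow> v \<notin> S)"
    if q: "classes {a} X Y Z" and xy: "x \<in> X" "y \<in> Y" for X Y Z x y
  proof -
    note cover = classes_cover [OF q]
    obtain v where v: "v \<in> verts G" "v \<notin> {a, x, y}"
      and nd: "\<And>s S. s \<in> {a, x, y} \<Longrightarrow> s \<in> S \<Longrightarrow> \<not> dominates v S"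
      and nc: "\<And>s S. s \<in> {a, x, y} \<Longrightarrow> complete_to s S \<Longrightarrow> v \<notin> S"
      by (rule avoiding_vertex [of a x y]) (use cover xy in auto)
    have "dominates v Z"
      using classes_dominate [OF q v(1)] nd xy by blast
    then have "complete_to v Z" "v \<notin> Z"
      using dominates_nontrivial [of v Z] nt [OF q] by simp_all
    then show ?thesis
      using v nc cover by blast
  qed
  have no_2_cycle: "\<not> Y \<leadsto> X" if q: "classes {a} X Y Z" and XY: "X \<leadsto> Y" for X Y Z
    using XY avoid [OF q] unfolding arrow_def by blast
  \<comment> \<open>The vertex avoiding \<open>a\<close>, \<open>x\<close>, \<open>y\<close> is not
    in \<open>Y\<close>, as \<open>x\<close> is complete to \<open>Y\<close>; so it is in
    \<open>X\<close>, and it is complete to \<open>Z\<close>.\<close>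
  have transitive: "X \<leadsto> Z" if q: "classes {a} X Y Z" and arrows: "X \<leadsto> Y" "Y \<leadsto> Z" for X Y Z
  proof -
    obtain x y where xy: "x \<in> X" "complete_to x Y" "y \<in> Y" "complete_to y Z"
      using arrows unfolding arrow_def by blast
    show ?thesis
      using avoid [OF q xy(1,3)] xy(2) unfolding arrow_def by blast
  qed
  have indegree: "X \<leadsto> Z \<or> Y \<leadsto> Z" if q: "classes {a} X Y Z" for X Y Z
    using classes_nonempty [OF q] avoid [OF q] unfolding arrow_def by blast
  have no_3_cycle: "\<not> (X \<leadsto> Y \<and> Y \<leadsto> Z \<and> Z \<leadsto> X)" if q: "classes {a} X Y Z" for X Y Z
    using transitive [OF q] no_2_cycle [OF classes_swap(3) [OF q]] by blast
  have q: "classes {a} X Y Z" "classes {a} X Z Y" "classes {a} Y X Z" "classes {a} Y Z X"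
    "classes {a} Z X Y" "classes {a} Z Y X"
    using assms classes_swap by blast+
  show False
    using q [THEN indegree] q [THEN no_2_cycle] q [THEN no_3_cycle] by argo
qed

end

section \<open>Colorings without singleton classes\<close>

locale dominator_4_coloring_nontrivial = dominator_4_coloring +
  assumes nontrivial_class: "X \<in> C \<Longrightarrow> nontrivial X"
begin

lemma nt: "classes X Y Z W \<Longrightarrow> nontrivial X \<and> nontrivial Y \<and> nontrivial Z \<and> nontrivial W"
  using nontrivial_class by (simp add: classes_def)

text \<open>A vertex of a nontrivial class cannot dominate its own class.\<close>

lemma outgoing:
  assumes q: "classes X Y Z W" and "x \<in> X"
  shows "complete_to x Y \<or> complete_to x Z \<or> complete_to x W"
proof -
  have "x \<in> verts G"
    using classes_cover [OF q] assms(2) by blast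
  then show ?thesis
    using classes_dominate [OF q] dominates_nontrivial nt [OF q] assms(2) by blast
qed

lemma avoiding:
  assumes q: "classes X Y Z W" and x: "x \<in> X" and y: "y \<in> Y" and z: "z \<in> Z"
  shows "\<exists>v \<in> X \<union> Y \<union> Z. v \<notin> {x, y, z} \<and> \<not> v \<sim> x \<and> \<not> v \<sim> y \<and> \<not> v \<sim> z \<and>
    complete_to v W \<and> (\<forall>S. complete_to x S \<or> complete_to y S \<or> complete_to z S \<longrightarrow> v \<notin> S)"
proof -
  note cover = classes_cover [OF q]
  obtain v where v: "v \<in> verts G" "v \<notin> {x, y, z}"
    and adj: "\<And>s. s \<in> {x, y, z} \<Longrightarrow> \<not> v \<sim> s \<and> \<not> s \<sim> v"
    and nd: "\<And>s S. s \<in> {x, y, z} \<Longrightarrow> s \<in> S \<Longrightarrow> \<not> dominates v S"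
    and nc: "\<And>s S. s \<in> {x, y, z} \<Longrightarrow> complete_to s S \<Longrightarrow> v \<notin> S"
    by (rule avoiding_vertex [of x y z]) (use cover x y z in auto)
  have "dominates v W"
    using classes_dominate [OF q v(1)] nd x y z by blast
  then have W: "complete_to v W" "v \<notin> W"
    using dominates_nontrivial [of v W] nt [OF q] by simp_all
  then have "v \<in> X \<union> Y \<union> Z"
    using v(1) cover by blast
  then show ?thesis
    using v(2) adj nc W by (intro bexI [of _ v] conjI) blast+
qed

text \<open>The witnesses of the three arrows leave no class for the vertex that avoids
  them.\<close>

lemma no_3_cycle:
  assumes q: "classes X Y Z W" and "X \<leadsto> Y" "Y \<leadsto> Z" "Z \<leadsto> X"
  shows False
proof -
  obtain x y z where "x \<in> X" "complete_to x Y" "y \<in> Y" "complete_to y Z" "z \<in> Z" "complete_to z X"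
    using assms unfolding arrow_def by blast
  then show False
    using avoiding [OF q, of x y z] by blast
qed

text \<open>Every class has an outgoing arrow. Without 2-cycles and 3-cycles, following arrows from
  \<open>X\<close> forces the 4-cycle \<open>X\<close>, \<open>Y\<close>, \<open>Z\<close>,
  \<open>W\<close>.\<close>

lemma two_cycle_exists: "classes X Y Z W \<Longrightarrow> \<exists>X Y Z W. classes X Y Z W \<and> X \<leadsto> Y \<and> Y \<leadsto> X"
proof (rule ccontr)
  assume "classes X Y Z W" and no: "\<nexists>X Y Z W. classes X Y Z W \<and> X \<leadsto> Y \<and> Y \<leadsto> X"
  have out: "X \<leadsto> Y \<or> X \<leadsto> Z \<or> X \<leadsto> W" if q: "classes X Y Z W" for X Y Z W
    using outgoing [OF q] classes_nonempty [OF q] unfolding arrow_def by blast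
  obtain X Y Z W where q: "classes X Y Z W" and XY: "X \<leadsto> Y"
    using out [OF \<open>classes X Y Z W\<close>] \<open>classes X Y Z W\<close> classes_swap(2) [OF \<open>classes X Y Z W\<close>]
      classes_swap(2) [OF classes_swap(3) [OF \<open>classes X Y Z W\<close>]] by blast
  have "\<not> Y \<leadsto> X"
    using no q XY by blast
  then obtain Z W where q: "classes X Y Z W" and YZ: "Y \<leadsto> Z"
    using out [OF classes_swap(1) [OF q]] q classes_swap(3) [OF q] by blast
  note XZYW = classes_swap(2) [OF q] and YZXW = classes_swap(2) [OF classes_swap(1) [OF q]]
    and XWYZ = classes_swap(2) [OF classes_swap(3) [OF q]]
  note ZXYW = classes_swap(1) [OF XZYW]
  note ZWXY = classes_swap(2) [OF classes_swap(3) [OF ZXYW]]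
  have "\<not> Z \<leadsto> X" "\<not> Z \<leadsto> Y"
    using no_3_cycle [OF q XY YZ] no YZXW YZ by blast+
  then have ZW: "Z \<leadsto> W"
    using out [OF ZXYW] by blast
  have "\<not> W \<leadsto> Y" "\<not> W \<leadsto> Z"
    using no_3_cycle [OF classes_swap(3) [OF YZXW] YZ ZW] no ZWXY ZW by blast+
  then have WX: "W \<leadsto> X"
    using out [OF classes_swap(1) [OF XWYZ]] by blast
  have "\<not> X \<leadsto> Z" "\<not> X \<leadsto> W"
    using no_3_cycle [OF classes_swap(3) [OF XZYW] _ ZW WX] no XWYZ WX by blast+
  \<comment> \<open>\<open>Y\<close> is the only class that \<open>X\<close> has an arrow to, so
    every vertex of \<open>X\<close> must be complete to it. Adjacency being symmetric, this gives
    the reverse arrow.\<close>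
  then have "complete_to x Y" if "x \<in> X" for x
    using outgoing [OF q that] that unfolding arrow_def by blast
  then have "Y \<leadsto> X"
    using classes_nonempty [OF q] adj_sym unfolding arrow_def complete_to_def by blast
  then show False
    using q XY no by blast
qed

text \<open>The vertex avoiding \<open>x\<close>, \<open>y\<close>, \<open>z\<close> is excluded
  from \<open>X\<close> by \<open>y\<close> and from \<open>Y\<close> by \<open>x\<close>. As
  \<open>z\<close> is arbitrary, a second application with \<open>v\<close> in its place gives
  another such vertex.\<close>

lemma two_cycle_opposite:
  assumes q: "classes X Y Z W" and x: "x \<in> X" "complete_to x Y" and y: "y \<in> Y" "complete_to y X"
    and z: "z \<in> Z"
  shows "\<exists>v \<in> Z. v \<noteq> z \<and> complete_to v W \<and> \<not> v \<sim> x \<and> \<not> v \<sim> y"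
  using avoiding [OF q x(1) y(1) z] x(2) y(2) by blast

definition two_complete :: "'a set \<Rightarrow> 'a set \<Rightarrow> bool" where
  "two_complete X Y \<longleftrightarrow> (\<exists>x \<in> X. \<exists>x' \<in> X. x \<noteq> x' \<and> complete_to x Y \<and> complete_to x' Y)"

lemma two_complete_imp_arrow: "two_complete X Y \<Longrightarrow> X \<leadsto> Y"
  by (auto simp: two_complete_def arrow_def)

text \<open>The 2-cycle on \<open>X\<close> and \<open>Y\<close> produces two complete vertices in
  each of \<open>Z\<close> and \<open>W\<close>. These form a 2-cycle, which acts back on
  \<open>X\<close> and \<open>Y\<close> in the same way.\<close>

lemma two_cycle_two_complete:
  assumes q: "classes X Y Z W" and "X \<leadsto> Y" "Y \<leadsto> X"
  shows "two_complete X Y" "two_complete Y X" "two_complete Z W" "two_complete W Z"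
proof -
  have *: "two_complete Z W" if q: "classes X Y Z W" and arrows: "X \<leadsto> Y" "Y \<leadsto> X" for X Y Z W
  proof -
    obtain x y where xy: "x \<in> X" "complete_to x Y" "y \<in> Y" "complete_to y X"
      using arrows by (auto simp: arrow_def)
    obtain z where "z \<in> Z"
      using classes_nonempty [OF q] by auto
    then show ?thesis
      using two_cycle_opposite [OF q xy] unfolding two_complete_def by metis
  qed
  show ZW: "two_complete Z W" and WZ: "two_complete W Z"
    using * [OF q] * [OF classes_swap(3) [OF q]] assms by auto
  have "classes Z W X Y" "classes Z W Y X"
    using q classes_swap by blast+
  then show "two_complete X Y" "two_complete Y X"
    using * [of Z W] ZW WZ two_complete_imp_arrow by blast+
qed

section \<open>Two-cycles of classes in planar graphs\<close>

lemma no_K33: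
  assumes "planar G" "distinct [a0, a1, a2, b0, b1, b2]"
    "a0 \<sim> b0" "a0 \<sim> b1" "a0 \<sim> b2" "a1 \<sim> b0" "a1 \<sim> b1" "a1 \<sim> b2" "a2 \<sim> b0" "a2 \<sim> b1"
    "b2 \<sim> w" "w \<sim> z" "z \<sim> a2" "w \<notin> {a0, a1, b0, b1}" "z \<notin> {a0, a1, b0, b1}"
  shows False
proof -
  have "wf_digraph G"
    using graph by (simp add: graph_def digraph_def fin_digraph_def)
  then show False
    by (rule planar_no_K33 [OF \<open>planar G\<close> _ adj_sym assms(2-)])
qed

text \<open>If \<open>x\<close> misses some of \<open>Y\<close>, it is complete to \<open>Z\<close>,
  say. Two complete vertices on each side, \<open>x\<close>, and a suitable \<open>y\<close> in
  \<open>Y\<close> give the bipartite graph up to the edge from \<open>y\<close> to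
  \<open>x\<close>, which the walk \<open>y\<close>, \<open>w\<close>, \<open>z\<close>,
  \<open>x\<close> replaces.\<close>

lemma two_cycle_complete:
  assumes "planar G" and q: "classes X Y Z W" and cyc: "X \<leadsto> Y" "Y \<leadsto> X" and x: "x \<in> X"
  shows "complete_to x Y"
proof (rule ccontr)
  assume nc: "\<not> complete_to x Y"
  have *: False if q: "classes X Y Z W" and cyc: "X \<leadsto> Y" "Y \<leadsto> X" and x: "x \<in> X" "\<not> complete_to x Y"
    and xZ: "complete_to x Z" for Z W
  proof -
    note two = two_cycle_two_complete [OF q cyc]
    obtain x1 x2 where x12: "x1 \<in> X" "x2 \<in> X" "x1 \<noteq> x2" "complete_to x1 Y" "complete_to x2 Y"
      using two(1) unfolding two_complete_def by blast
    obtain y1 y2 where y12: "y1 \<in> Y" "y2 \<in> Y" "y1 \<noteq> y2" "complete_to y1 X" "complete_to y2 X"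
      using two(2) unfolding two_complete_def by blast
    obtain z where z: "z \<in> Z" "complete_to z W"
      using two(3) unfolding two_complete_def by blast
    obtain y where "y \<in> X \<union> Y \<union> Z" and y: "\<not> y \<sim> x" "complete_to y W"
      and "\<forall>S. complete_to x S \<or> complete_to y1 S \<or> complete_to z S \<longrightarrow> y \<notin> S"
      using avoiding [OF q x(1) y12(1) z(1)] by blast
    \<comment> \<open>\<open>y\<close> is not in \<open>Z\<close> because of \<open>x\<close>, and
      not in \<open>X\<close> because of \<open>y1\<close>.\<close>
    then have yY: "y \<in> Y" "complete_to y W"
      using xZ y12(4) by blast+
    obtain w where w: "w \<in> W"
      using classes_nonempty [OF q] by auto
    have "x \<notin> {x1, x2}" "y \<notin> {y1, y2}"
      using x x12(4,5) y12(4,5) y(1) complete_toD by blast+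
    then have "distinct [x1, x2, x, y1, y2, y]" "w \<notin> {x1, x2, y1, y2}" "z \<notin> {x1, x2, y1, y2}"
      using x12 y12 x yY w z classes_disjoint [OF q] by auto
    moreover have "x1 \<sim> y1" "x1 \<sim> y2" "x1 \<sim> y" "x2 \<sim> y1" "x2 \<sim> y2" "x2 \<sim> y" "y \<sim> w" "z \<sim> w"
      "x \<sim> z" "y1 \<sim> x" "y2 \<sim> x"
      using x12 y12 x(1) yY w z xZ by (simp_all add: complete_to_def)
    moreover from this have "w \<sim> z" "z \<sim> x" "x \<sim> y1" "x \<sim> y2"
      using adj_sym by blast+
    ultimately show False
      using no_K33 [OF \<open>planar G\<close>, of x1 x2 x y1 y2 y w z] by blast
  qed
  have "complete_to x Z \<or> complete_to x W"
    using outgoing [OF q x] nc by auto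
  then show False
    using * [OF q cyc x nc] * [OF classes_swap(3) [OF q] cyc x nc] by blast
qed

lemma three_elements:
  assumes "X \<noteq> {}" "nontrivial X" "\<nexists>u v. X = {u, v}"
  obtains u v w where "u \<in> X" "v \<in> X" "w \<in> X" "distinct [u, v, w]"
proof -
  obtain u where "u \<in> X" using assms(1) by blast
  moreover obtain v where "v \<in> X" "v \<noteq> u" using assms(2) calculation by blast
  moreover obtain w where "w \<in> X" "w \<noteq> u" "w \<noteq> v" using assms(3) calculation by blast
  ultimately show thesis using that by auto
qed

text \<open>By the previous lemma all edges between \<open>X\<close> and \<open>Y\<close> are
  present, so three vertices on either side would give the forbidden bipartite graph itself.\<close>

lemma two_cycle_pair:
  assumes "planar G" and q: "classes X Y Z W" and cyc: "X \<leadsto> Y" "Y \<leadsto> X"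
  shows "(\<exists>u v. X = {u, v}) \<or> (\<exists>u v. Y = {u, v})"
proof (rule ccontr)
  assume no: "\<not> ?thesis"
  obtain x1 x2 x3 where x: "x1 \<in> X" "x2 \<in> X" "x3 \<in> X" "distinct [x1, x2, x3]"
    using three_elements [of X] no nt [OF q] classes_nonempty [OF q] by metis
  obtain y1 y2 y3 where y: "y1 \<in> Y" "y2 \<in> Y" "y3 \<in> Y" "distinct [y1, y2, y3]"
    using three_elements [of Y] no nt [OF q] classes_nonempty [OF q] by metis
  have adj: "u \<sim> v" if "u \<in> X" "v \<in> Y" for u v
    using complete_toD [OF two_cycle_complete [OF assms that(1)] that(2)] .
  then have adj': "v \<sim> u" if "u \<in> X" "v \<in> Y" for u v
    using that adj_sym by blast
  have "u \<noteq> v" if "u \<in> X" "v \<in> Y" for u v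
    using that classes_disjoint [OF q] by auto
  then show False
    using no_K33 [OF \<open>planar G\<close>, of x1 x2 x3 y1 y2 y3 x3 y3] x y adj adj' by auto
qed

text \<open>Both opposite 2-cycles contain a class of size two, say \<open>X\<close> and
  \<open>Z\<close>. Then \<open>Z\<close> has no edges to \<open>X\<close> and \<open>Y\<close>, and
  \<open>X\<close> has none to \<open>Z\<close> and \<open>W\<close>, so \<open>Y \<union> Z\<close>
  and \<open>X \<union> W\<close> form a 2-coloring.\<close>

lemma not_planar:
  assumes "classes X Y Z W"
  shows "\<not> planar G"
proof
  assume pl: "planar G"
  obtain X Y Z W where q: "classes X Y Z W" and cyc: "X \<leadsto> Y" "Y \<leadsto> X"
    using two_cycle_exists [OF assms] by blast
  then obtain X Y where q: "classes X Y Z W" and cyc: "X \<leadsto> Y" "Y \<leadsto> X" and X: "\<exists>u v. X = {u, v}"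
    using two_cycle_pair [OF pl q cyc] classes_swap(1) [OF q] by blast
  have "Z \<leadsto> W" "W \<leadsto> Z"
    using two_cycle_two_complete [OF q cyc] two_complete_imp_arrow by blast+
  moreover have "classes Z W X Y"
    using q classes_swap by blast
  ultimately have "(\<exists>u v. Z = {u, v}) \<or> (\<exists>u v. W = {u, v})"
    using two_cycle_pair [OF pl] by blast
  then obtain Z W where q: "classes X Y Z W" and Z: "\<exists>u v. Z = {u, v}"
    using q classes_swap(3) by blast
  have cyc': "Z \<leadsto> W" "W \<leadsto> Z"
    using two_cycle_two_complete [OF q cyc] two_complete_imp_arrow by blast+
  have far: "\<not> z \<sim> x \<and> \<not> z \<sim> y"
    if q: "classes X Y Z W" and cyc: "X \<leadsto> Y" "Y \<leadsto> X" and Z: "\<exists>u v. Z = {u, v}"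
      and "x \<in> X" "y \<in> Y" "z \<in> Z" for X Y Z W x y z
  proof -
    have x: "complete_to x Y" and y: "complete_to y X"
      using two_cycle_complete [OF pl q cyc] two_cycle_complete [OF pl classes_swap(1) [OF q]] that
      by auto
    obtain z' where "z' \<in> Z" "z' \<noteq> z" "Z = {z, z'}"
      using Z nt [OF q] \<open>z \<in> Z\<close> by auto
    \<comment> \<open>As \<open>Z\<close> has only two elements, avoiding \<open>z'\<close> makes
      \<open>v\<close> equal to the given \<open>z\<close>.\<close>
    obtain v where "v \<in> Z" "v \<noteq> z'" "\<not> v \<sim> x" "\<not> v \<sim> y"
      using two_cycle_opposite [OF q \<open>x \<in> X\<close> x \<open>y \<in> Y\<close> y \<open>z' \<in> Z\<close>] by blast
    then show ?thesis
      using \<open>Z = {z, z'}\<close> by blast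
  qed
  have q': "classes Z W X Y"
    using q classes_swap by blast
  have "\<not> z \<sim> y" "\<not> y \<sim> z" if "z \<in> Z" "y \<in> Y" for z y
  proof -
    obtain x where "x \<in> X"
      using classes_nonempty [OF q] by blast
    then show "\<not> z \<sim> y"
      using far [OF q cyc Z] that by blast
    then show "\<not> y \<sim> z"
      using adj_sym by blast
  qed
  then have YZ: "independent_set G (Y \<union> Z)"
    using classes_independent [OF q] unfolding independent_set_def by blast
  have "\<not> x \<sim> w" "\<not> w \<sim> x" if "x \<in> X" "w \<in> W" for x w
  proof -
    obtain z where "z \<in> Z"
      using classes_nonempty [OF q] by blast
    then show "\<not> x \<sim> w"
      using far [OF q' cyc' X] that by blast
    then show "\<not> w \<sim> x"
      using adj_sym by blast
  qed
  then have XW: "independent_set G (X \<union> W)"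
    using classes_independent [OF q] unfolding independent_set_def by blast
  show False
    by (rule not_3_colorable [OF YZ XW, of "{}"])
      (use classes_disjoint [OF q] classes_cover [OF q] in \<open>auto simp: independent_set_def\<close>)
qed

end

lemma (in dominator_4_coloring) not_planar_if_card_4:
  assumes "card C = 4"
  shows "\<not> planar G"
proof -
  have "finite C"
    using assms card.infinite by fastforce
  then obtain Ss where Ss: "set Ss = C" "distinct Ss"
    using finite_distinct_list by blast
  then have "length Ss = 4"
    using assms distinct_card by metis
  then obtain X Y Z W where "Ss = [X, Y, Z, W]"
    by (auto simp: length_Suc_conv numeral_eq_Suc)
  then have q: "classes X Y Z W"
    using Ss by (auto simp: classes_def)
  show ?thesis
  proof (cases "\<exists>S \<in> C. \<exists>a. S = {a}")
    case True
    then obtain a where "a \<in> verts G" "{a} \<in> C"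
      using coloring
      by (auto simp: dominator_coloring_def proper_coloring_def partition_on_def)
    then have "{a} \<in> {X, Y, Z, W}"
      using q by (simp add: classes_def)
    then have "\<exists>X Y Z. classes {a} X Y Z"
      using q classes_swap by (metis insert_iff singletonD)
    then show ?thesis
      using one_singleton by blast
  next
    case False
    then interpret dominator_4_coloring_nontrivial G C
      by unfold_locales auto
    show ?thesis
      using q by (rule not_planar)
  qed
qed

section \<open>Invariants as least values\<close>

lemma domination_number_le:
  "dominating_set G D \<Longrightarrow> domination_number G \<le> card D"
  unfolding domination_number_def by (rule Least_le) blast

lemma chromatic_number_le: "proper_coloring G C \<Longrightarrow> chromatic_number G \<le> card C"
  unfolding chromatic_number_def by (rule Least_le) blast

text \<open>This witnesses that dominator colorings exist, so that the least number of colors is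
  attained.\<close>

lemma (in loopfree_digraph) dominator_coloring_singletons:
  "dominator_coloring G ((\<lambda>v. {v}) ` verts G)"
  unfolding dominator_coloring_def proper_coloring_def partition_on_def independent_set_def
    dominates_class_def disjoint_def using adj_not_same by auto

lemma (in loopfree_digraph) dominator_chromatic_number_attained:
  obtains C where "dominator_coloring G C" "card C = dominator_chromatic_number G"
  using LeastI_ex [of "\<lambda>k. \<exists>C. dominator_coloring G C \<and> card C = k"] dominator_coloring_singletons
  unfolding dominator_chromatic_number_def by metis

text \<open>Empty sets are removed first, since a partition has nonempty classes.\<close>

lemma chromatic_number_le_3:
  assumes "independent_set G S" "independent_set G T" "independent_set G U"
    and "S \<inter> T = {}" "S \<inter> U = {}" "T \<inter> U = {}" "S \<union> T \<union> U = verts G"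
  shows "chromatic_number G \<le> 3"
proof -
  have "\<Union> ({S, T, U} - {{}}) = verts G"
    using assms(7) by auto
  moreover have "disjoint ({S, T, U} - {{}})"
    unfolding disjoint_def using assms(4-6) by blast
  moreover have "\<forall>R \<in> {S, T, U} - {{}}. independent_set G R"
    using assms(1-3) by blast
  ultimately have "proper_coloring G ({S, T, U} - {{}})"
    by (simp add: proper_coloring_def partition_on_def)
  then have "chromatic_number G \<le> card ({S, T, U} - {{}})"
    by (rule chromatic_number_le)
  also have "\<dots> \<le> card {S, T, U}"
    by (intro card_mono) auto
  also have "\<dots> \<le> 3"
    by (simp add: card_insert_if)
  finally show ?thesis .
qed

theorem theorem4:
  fixes G :: "('a, 'b) pre_digraph"
  assumes "graph G"
    and "Digraph_Component.connected G"
    and "planar G"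
  shows "\<not> D_graph 4 G"
proof
  assume D: "D_graph 4 G"
  interpret graph G by fact
  obtain C where C: "dominator_coloring G C" "card C = 4"
    using dominator_chromatic_number_attained D by (auto simp: D_graph_def)
  have "dominator_4_coloring G C"
  proof
    fix x y z
    assume xyz: "x \<in> verts G" "y \<in> verts G" "z \<in> verts G"
    have "card {x, y, z} \<le> 3"
      by (simp add: card_insert_if)
    then have "\<not> dominating_set G {x, y, z}"
      using domination_number_le [of G "{x, y, z}"] D by (auto simp: D_graph_def)
    then show "\<exists>v \<in> verts G. v \<notin> {x, y, z} \<and> \<not> v \<rightarrow>\<^bsub>G\<^esub> x \<and> \<not> v \<rightarrow>\<^bsub>G\<^esub> y \<and> \<not> v \<rightarrow>\<^bsub>G\<^esub> z"
      using xyz graph_symmetric unfolding dominating_set_def by blast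
  next
    fix S T U
    assume "independent_set G S" "independent_set G T" "independent_set G U"
      "S \<inter> T = {}" "S \<inter> U = {}" "T \<inter> U = {}" "S \<union> T \<union> U = verts G"
    then show False
      using chromatic_number_le_3 [of G S T U] D by (auto simp: D_graph_def)
  qed (use assms C in auto)
  then show False
    using dominator_4_coloring.not_planar_if_card_4 C assms by blast
qed

end
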